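(* Let $p$ be a prime number and let $A$ and $B$ be nonempty subsets of $\mathbb{Z}/p\mathbb{Z}$ with $|A|\neq |B|$. Then the restricted sumset $A\dot{+}B=\{a+b:\ a\in A,\ b\in B,\ a\neq b\}$ satisfies $$|A\dot{+}B|\geqslant \min\{p,\ |A|+|B|-2\}.$$
   Context: $\mathbb{Z}/p\mathbb{Z}$ is the finite field of integers modulo the prime $p$, and $|S|$ denotes the cardinality of a finite set $S$. The inequality is between integers. *)

theory Defs
  imports "HOL-Number_Theory.Residues"
begin

definition restricted_sumset :: "('a, 'm) ring_scheme \<Rightarrow> 'a set \<Rightarrow> 'a set \<Rightarrow> 'a set" where
  "restricted_sumset R A B = {a \<oplus>\<^bsub>R\<^esub> b | a b. a \<in> A \<and> b \<in> B \<and> a \<noteq> b}"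

end

theory Submission
  imports Defs "HOL-Computational_Algebra.Polynomial"
begin

text \<open>
  The polynomial method of Alon, Nathanson and Ruzsa, with a duality argument in place of the
  Combinatorial Nullstellensatz. Write \<open>k\<close> and \<open>l\<close> for the cardinalities of \<open>A\<close> and \<open>B\<close>; after
  shrinking one of the sets, \<open>k + l - 2 \<le> p\<close>. There is a weight \<open>u\<close> on \<open>A\<close> whose moments of order
  below \<open>k - 1\<close> vanish modulo \<open>p\<close> and whose moment of order \<open>k - 1\<close> does not, and similarly a
  weight \<open>v\<close> on \<open>B\<close>. Summing a polynomial of degree at most \<open>k + l - 2\<close> over \<open>A \<times> B\<close> against
  \<open>u \<otimes> v\<close> extracts, up to a unit, its coefficient at \<open>x\<^sup>k\<^sup>-\<^sup>1 y\<^sup>l\<^sup>-\<^sup>1\<close>. If the restricted sumset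
  were contained in a set \<open>C\<close> with at most \<open>k + l - 3\<close> elements, then \<open>(x - y) \<Prod>\<^sub>c (x + y - c)\<close>,
  times a power of \<open>x + y\<close>, would vanish on \<open>A \<times> B\<close>, although that coefficient is
  \<open>(k - l) (k + l - 3)! / ((k - 1)! (l - 1)!)\<close>, a unit modulo \<open>p\<close>.
\<close>

text \<open>The weight built is, modulo \<open>p\<close>, the divided difference at the points of
  \<open>A\<close>, that is \<open>u a = 1 / \<Prod>(a - c)\<close> over the other points
  \<open>c\<close>. Distinct points of \<open>{0..<p}\<close> are incongruent, so the inverses
  exist.\<close>

lemma exists_moment_weight:
  fixes p :: int and A :: "int set"
  assumes p: "prime p" and "finite A" "A \<noteq> {}" "A \<subseteq> {0..<p}"
  obtains u where "\<And>i. i < card A - 1 \<Longrightarrow> p dvd (\<Sum>a\<in>A. u a * a ^ i)"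
    and "\<not> p dvd (\<Sum>a\<in>A. u a * a ^ (card A - 1))"
proof -
  have "\<exists>u. (\<forall>i < card A - 1. p dvd (\<Sum>a\<in>A. u a * a ^ i))
      \<and> \<not> p dvd (\<Sum>a\<in>A. u a * a ^ (card A - 1))"
    using assms(2-4)
  proof (induction A rule: finite_ne_induct)
    case (singleton a)
    have "\<not> p dvd 1" using p by (simp add: prime_int_iff)
    then show ?case by (intro exI[of _ "\<lambda>_. 1"]) auto
  next
    case (insert b A)
    let ?k = "card A"
    have k: "?k > 0" using insert.hyps by (simp add: card_gt_0_iff)
    from insert obtain u where u: "\<And>i. i < ?k - 1 \<Longrightarrow> p dvd (\<Sum>a\<in>A. u a * a ^ i)"
      "\<not> p dvd (\<Sum>a\<in>A. u a * a ^ (?k - 1))" by auto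
    have "\<exists>w. p dvd (a - b) * w - 1" if "a \<in> A" for a
    proof -
      have "a \<in> {0..<p}" "b \<in> {0..<p}" "a \<noteq> b" using that insert.hyps insert.prems by auto
      then have "a \<noteq> b" "\<bar>a - b\<bar> < p" by auto
      then have "\<not> p dvd a - b" using dvd_imp_le_int[of "a - b" p] by auto
      then have "coprime (a - b) p" using p by (metis coprime_commute prime_imp_coprime)
      then show ?thesis by (metis cong_iff_dvd_diff cong_solve_coprime_int)
    qed
    then obtain w where w: "\<And>a. a \<in> A \<Longrightarrow> p dvd (a - b) * w a - 1" by metis
    \<comment> \<open>Old weights are divided by \<open>a - b\<close> modulo \<open>p\<close>; the
      value at \<open>b\<close> is chosen to make the zeroth moment exactly 0.\<close>
    define u' where "u' a = (if a = b then - (\<Sum>c\<in>A. u c * w c) else u a * w a)" for a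
    define M where "M i = (\<Sum>a\<in>insert b A. u' a * a ^ i)" for i
    have u'A: "u' a = u a * w a" if "a \<in> A" for a using that insert.hyps by (auto simp: u'_def)
    have M0: "M 0 = 0"
      using insert.hyps u'A by (simp add: M_def u'_def)
    \<comment> \<open>The factor \<open>a - b\<close> removes the new point and cancels
      \<open>w a\<close>, so each new moment is \<open>b\<close> times the previous one plus an old
      moment.\<close>
    have step: "p dvd M (Suc i) - b * M i - (\<Sum>a\<in>A. u a * a ^ i)" for i
    proof -
      have "M (Suc i) - b * M i = (\<Sum>a\<in>insert b A. u' a * ((a - b) * a ^ i))"
        unfolding M_def sum_distrib_left sum_subtractf[symmetric]
        by (intro sum.cong) (auto simp: algebra_simps)
      also have "\<dots> = (\<Sum>a\<in>A. u' a * ((a - b) * a ^ i))"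
        using insert.hyps by simp
      finally have "M (Suc i) - b * M i - (\<Sum>a\<in>A. u a * a ^ i)
          = (\<Sum>a\<in>A. ((a - b) * w a - 1) * (u a * a ^ i))"
        by (simp add: sum_subtractf[symmetric] u'A algebra_simps)
      also have "p dvd \<dots>" by (intro dvd_sum dvd_mult2 w)
      finally show ?thesis .
    qed
    have M: "p dvd M i" if "i < ?k" for i
      using that
    proof (induction i)
      case (Suc i)
      then have "p dvd b * M i + (\<Sum>a\<in>A. u a * a ^ i)" using u(1)[of i] by auto
      from dvd_add[OF step[of i] this] show ?case by simp
    qed (simp add: M0)
    have "\<not> p dvd M ?k"
    proof
      assume "p dvd M ?k"
      moreover have "p dvd b * M (?k - 1)" using M[of "?k - 1"] k by auto
      ultimately have "p dvd M ?k - b * M (?k - 1)" by (rule dvd_diff)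
      moreover have "p dvd M ?k - b * M (?k - 1) - (\<Sum>a\<in>A. u a * a ^ (?k - 1))"
        using step[of "?k - 1"] k by simp
      ultimately have "p dvd (\<Sum>a\<in>A. u a * a ^ (?k - 1))" by (simp only: dvd_diff_right_iff)
      with u(2) show False by contradiction
    qed
    with M show ?case
      using insert.hyps unfolding M_def by (intro exI[of _ u']) auto
  qed
  with that show thesis by blast
qed

text \<open>Evaluates the coefficient of \<open>x ^ s * y ^ t\<close> in
  \<open>(x - y) * (x + y) ^ n\<close>, with denominators cleared to stay in the integers. The
  \<open>if\<close> guards against truncated subtraction at \<open>s = 0\<close>.\<close>

lemma fact_mult_binomial_diff:
  fixes s t n :: nat
  assumes "s + t = Suc n"
  shows "fact s * fact t * ((if s = 0 then 0 else int (n choose (s - 1))) - int (n choose s))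
    = (int s - int t) * fact n"
proof (cases "s = 0 \<or> t = 0")
  case True
  with assms show ?thesis by auto
next
  case False
  then obtain s' t' where st: "s = Suc s'" "t = Suc t'" by (metis not0_implies_Suc)
  have n: "n = Suc s' + t'" "n = s' + Suc t'" using assms st by auto
  have 1: "fact s' * fact (Suc t') * (n choose s') = fact n"
    using binomial_fact_lemma[of s' n] n(2) by (metis add_diff_cancel_left' le_add1)
  have 2: "fact (Suc s') * fact t' * (n choose Suc s') = fact n"
    using binomial_fact_lemma[of "Suc s'" n] n(1) by (metis add_diff_cancel_left' le_add1)
  have 1: "fact s' * fact (Suc t') * int (n choose s') = fact n"
    using arg_cong[OF 1, of int] by (simp only: of_nat_mult of_nat_fact)
  have 2: "fact (Suc s') * fact t' * int (n choose Suc s') = fact n"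
    using arg_cong[OF 2, of int] by (simp only: of_nat_mult of_nat_fact)
  have "fact s * fact t * ((if s = 0 then 0 else int (n choose (s - 1))) - int (n choose s))
    = int s * (fact s' * fact (Suc t') * int (n choose s'))
      - int t * (fact (Suc s') * fact t' * int (n choose Suc s'))"
    by (simp add: st algebra_simps)
  also have "\<dots> = (int s - int t) * fact n" unfolding 1 2 by (simp add: algebra_simps)
  finally show ?thesis .
qed

lemma diff_mult_power_add:
  fixes x y :: int
  shows "(x - y) * (x + y) ^ m = (\<Sum>i\<le>Suc m.
    ((if i = 0 then 0 else int (m choose (i - 1))) - int (m choose i)) * (x ^ i * y ^ (Suc m - i)))"
proof -
  have "(x - y) * (x + y) ^ m
      = x * (\<Sum>i\<le>m. int (m choose i) * x ^ i * y ^ (m - i))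
        - y * (\<Sum>i\<le>m. int (m choose i) * x ^ i * y ^ (m - i))"
    by (simp only: binomial_ring left_diff_distrib)
  also have "x * (\<Sum>i\<le>m. int (m choose i) * x ^ i * y ^ (m - i))
      = (\<Sum>i\<le>Suc m. (if i = 0 then 0 else int (m choose (i - 1))) * (x ^ i * y ^ (Suc m - i)))"
    by (subst sum.atMost_Suc_shift) (simp add: sum_distrib_left algebra_simps)
  also have "y * (\<Sum>i\<le>m. int (m choose i) * x ^ i * y ^ (m - i))
      = (\<Sum>i\<le>Suc m. int (m choose i) * (x ^ i * y ^ (Suc m - i)))"
    by (simp add: sum_distrib_left Suc_diff_le algebra_simps binomial_eq_0)
  finally show ?thesis by (simp only: sum_subtractf[symmetric] left_diff_distrib)
qed

text \<open>Here \<open>C\<close> need only meet the residue class of each restricted sum. The bound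
  \<open>small\<close> gives \<open>n < p\<close> below, which makes \<open>fact n\<close> a unit
  modulo \<open>p\<close>.\<close>

lemma card_sum_cover_ge:
  fixes p :: int and A B C :: "int set"
  assumes p: "prime p"
    and A: "A \<noteq> {}" "A \<subseteq> {0..<p}" and B: "B \<noteq> {}" "B \<subseteq> {0..<p}"
    and neq: "card A \<noteq> card B" and small: "int (card A + card B) \<le> p + 2"
    and C: "finite C" "\<And>a b. a \<in> A \<Longrightarrow> b \<in> B \<Longrightarrow> a \<noteq> b \<Longrightarrow> \<exists>c\<in>C. p dvd a + b - c"
  shows "card A + card B - 2 \<le> card C"
proof (rule ccontr)
  assume less: "\<not> card A + card B - 2 \<le> card C"
  have fin: "finite A" "finite B"
    using A(2) B(2) by (auto intro: finite_subset)
  \<comment> \<open>Unequal cardinalities exclude \<open>s = t = 0\<close>, so the subtraction in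
    \<open>n\<close> does not truncate.\<close>
  define s t n where "s = card A - 1" and "t = card B - 1" and "n = s + t - 1"
  have card: "card A = Suc s" "card B = Suc t"
    using fin A(1) B(1) by (simp_all add: s_def t_def card_gt_0_iff)
  have n: "s + t = Suc n" using neq card by (simp add: n_def)
  have Cn: "card C \<le> n" using less card n by simp
  obtain u where u: "\<And>i. i < s \<Longrightarrow> p dvd (\<Sum>a\<in>A. u a * a ^ i)" "\<not> p dvd (\<Sum>a\<in>A. u a * a ^ s)"
    using exists_moment_weight[OF p fin(1) A] unfolding s_def by blast
  obtain v where v: "\<And>i. i < t \<Longrightarrow> p dvd (\<Sum>b\<in>B. v b * b ^ i)" "\<not> p dvd (\<Sum>b\<in>B. v b * b ^ t)"
    using exists_moment_weight[OF p fin(2) B] unfolding t_def by blast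
  define U where "U i = (\<Sum>a\<in>A. u a * a ^ i)" for i
  define V where "V i = (\<Sum>b\<in>B. v b * b ^ i)" for i
  \<comment> \<open>\<open>L\<close> factors on monomials: modulo \<open>p\<close> it kills
    \<open>x ^ i * y ^ j\<close> unless \<open>i \<ge> s\<close> and \<open>j \<ge> t\<close>, so in
    degree \<open>s + t\<close> only \<open>x ^ s * y ^ t\<close> can survive.\<close>
  define L where "L f = (\<Sum>a\<in>A. \<Sum>b\<in>B. u a * v b * f a b)" for f :: "int \<Rightarrow> int \<Rightarrow> int"
  define d where "d m i = (if i = 0 then 0 else int (m choose (i - 1))) - int (m choose i)" for m i
  have L_sum: "L (\<lambda>x y. \<Sum>i\<in>I. c i * f i x y) = (\<Sum>i\<in>I. c i * L (f i))"
    for I :: "nat set" and c f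
  proof -
    have "L (\<lambda>x y. \<Sum>i\<in>I. c i * f i x y) = (\<Sum>a\<in>A. \<Sum>i\<in>I. \<Sum>b\<in>B. c i * (u a * v b * f i a b))"
      unfolding L_def sum_distrib_left
      by (intro sum.cong refl, subst sum.swap) (simp add: algebra_simps)
    also have "\<dots> = (\<Sum>i\<in>I. c i * L (f i))"
      unfolding L_def sum_distrib_left by (rule sum.swap)
    finally show ?thesis .
  qed
  have L_mono: "L (\<lambda>x y. x ^ i * y ^ j) = U i * V j" for i j
    unfolding L_def U_def V_def sum_product by (simp add: algebra_simps)
  have L_form: "L (\<lambda>x y. (x - y) * (x + y) ^ m) = (\<Sum>i\<le>Suc m. d m i * (U i * V (Suc m - i)))" for m
    unfolding diff_mult_power_add d_def[symmetric] L_sum L_mono ..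
  have UV: "p dvd U i * V j" if "i < s \<or> j < t" for i j
    using that u(1) v(1) unfolding U_def V_def by (auto intro: dvd_mult dvd_mult2)
  have low: "p dvd L (\<lambda>x y. (x - y) * (x + y) ^ m)" if "m < n" for m
    unfolding L_form using that n by (intro dvd_sum dvd_mult UV) auto
  have top: "\<not> p dvd L (\<lambda>x y. (x - y) * (x + y) ^ n)"
  proof
    assume "p dvd L (\<lambda>x y. (x - y) * (x + y) ^ n)"
    moreover have "L (\<lambda>x y. (x - y) * (x + y) ^ n)
        = d n s * (U s * V t) + (\<Sum>i\<in>{..Suc n} - {s}. d n i * (U i * V (Suc n - i)))"
      unfolding L_form using n by (subst sum.remove[of _ s]) (auto simp flip: n)
    moreover have "p dvd (\<Sum>i\<in>{..Suc n} - {s}. d n i * (U i * V (Suc n - i)))"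
      using n by (intro dvd_sum dvd_mult UV) auto
    ultimately have "p dvd d n s * (U s * V t)" by (metis dvd_add_left_iff)
    then have "p dvd d n s"
      using p u(2) v(2) by (auto simp: U_def V_def prime_dvd_mult_iff)
    then have "p dvd fact s * fact t * d n s" by (rule dvd_mult)
    then have "p dvd (int s - int t) * fact n"
      using fact_mult_binomial_diff[OF n] by (simp only: d_def)
    then have "p dvd int s - int t \<or> p dvd fact n"
      using p by (simp add: prime_dvd_mult_iff)
    moreover have "\<not> p dvd fact n"
    proof -
      obtain q where q: "p = int q" using p by (metis prime_ge_0_int zero_le_imp_eq_int)
      have "prime q" using p q by simp
      moreover have "n < q" using small card n q by simp
      ultimately have "\<not> q dvd fact n" by (simp add: prime_dvd_fact_iff)
      then show ?thesis unfolding q by (metis of_nat_dvd_iff of_nat_fact)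
    qed
    \<comment> \<open>Both cardinalities lie between 1 and \<open>p\<close>, so they differ by less
      than \<open>p\<close>.\<close>
    moreover have "\<not> p dvd int s - int t"
    proof -
      have "card A \<le> nat p" "card B \<le> nat p"
        using card_mono[OF _ A(2)] card_mono[OF _ B(2)] by auto
      then have "\<bar>int s - int t\<bar> < p" "s \<noteq> t" using card neq by auto
      then show ?thesis using dvd_imp_le_int[of "int s - int t" p] by auto
    qed
    ultimately show False by blast
  qed
  \<comment> \<open>Monic, vanishing on \<open>C\<close>, and padded by a power of the variable to
    degree exactly \<open>n\<close>.\<close>
  define Q :: "int poly" where "Q = (\<Prod>c\<in>C. [:- c, 1:]) * monom 1 (n - card C)"
  have degP: "degree (\<Prod>c\<in>C. [:- c, 1:]) = card C" by (subst degree_prod_eq_sum_degree) auto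
  have leadP: "lead_coeff (\<Prod>c\<in>C. [:- c, 1:]) = 1" by (simp add: lead_coeff_prod)
  then have "(\<Prod>c\<in>C. [:- c, 1:]) \<noteq> 0" by force
  then have Q1: "degree Q = n"
    using Cn degP by (simp add: Q_def degree_mult_eq degree_monom_eq)
  have "lead_coeff Q = 1"
    unfolding Q_def lead_coeff_mult leadP by (simp add: degree_monom_eq)
  with Q1 have Q: "degree Q = n" "coeff Q n = 1" by auto
  have polyQ: "poly Q x = (\<Prod>c\<in>C. x - c) * x ^ (n - card C)" for x
    by (simp add: Q_def poly_prod poly_monom algebra_simps)
  have "p dvd L (\<lambda>x y. (x - y) * poly Q (x + y))"
    unfolding L_def
  proof (intro dvd_sum, rule dvd_mult)
    fix a b assume ab: "a \<in> A" "b \<in> B"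
    show "p dvd (a - b) * poly Q (a + b)"
    proof (cases "a = b")
      case False
      then obtain c where "c \<in> C" "p dvd a + b - c" using C(2) ab by blast
      then have "p dvd (\<Prod>c\<in>C. a + b - c)" using C(1) by (meson dvd_prodI dvd_trans)
      then show ?thesis by (simp add: polyQ)
    qed simp
  qed
  \<comment> \<open>Expanding \<open>Q\<close> in powers of \<open>x + y\<close> leaves only the
    leading power modulo \<open>p\<close>, by \<open>low\<close>.\<close>
  also have "L (\<lambda>x y. (x - y) * poly Q (x + y))
      = L (\<lambda>x y. \<Sum>m\<le>n. coeff Q m * ((x - y) * (x + y) ^ m))"
    unfolding poly_altdef Q(1) sum_distrib_left by (simp only: mult.left_commute)
  also have "\<dots> = (\<Sum>m\<le>n. coeff Q m * L (\<lambda>x y. (x - y) * (x + y) ^ m))"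
    by (rule L_sum)
  also have "\<dots> = (\<Sum>m<n. coeff Q m * L (\<lambda>x y. (x - y) * (x + y) ^ m))
      + L (\<lambda>x y. (x - y) * (x + y) ^ n)"
    by (simp add: lessThan_Suc_atMost[symmetric] Q(2))
  finally have "p dvd L (\<lambda>x y. (x - y) * (x + y) ^ n)"
    using low by (subst (asm) dvd_add_right_iff) (auto intro!: dvd_sum)
  with top show False by contradiction
qed

text \<open>Cutting only the smaller set keeps the cardinalities distinct; the larger has at most
  \<open>p\<close> elements, so at least two remain in the other. The total \<open>p + 2\<close> is
  where the bound reaches \<open>p\<close>.\<close>

lemma exists_subsets_card_sum_le:
  fixes p :: nat
  assumes "finite A" "A \<noteq> {}" "card A \<le> p" "finite B" "B \<noteq> {}" "card B \<le> p" "card A \<noteq> card B"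
  obtains A' B' where "A' \<subseteq> A" "A' \<noteq> {}" "B' \<subseteq> B" "B' \<noteq> {}" "card A' \<noteq> card B'"
    "card A' + card B' = min (p + 2) (card A + card B)"
proof -
  consider "card A + card B \<le> p + 2" | "card A + card B > p + 2" "card B < card A"
    | "card A + card B > p + 2" "card A < card B"
    using assms by linarith
  then show thesis
  proof cases
    case 1
    with assms that[of A B] show thesis by simp
  next
    case 2
    then have "p + 2 - card A \<le> card B" by linarith
    then obtain B' where "B' \<subseteq> B" "card B' = p + 2 - card A"
      by (rule obtain_subset_with_card_n)
    moreover have "card B' > 0" "card B' < card A" "card A + card B' = p + 2"
      using \<open>card B' = _\<close> 2 assms(3,6) by linarith+
    moreover from this have "B' \<noteq> {}" by auto
    ultimately show thesis using 2 assms(2,5) by (intro that[of A B']) auto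
  next
    case 3
    then have "p + 2 - card B \<le> card A" by linarith
    then obtain A' where "A' \<subseteq> A" "card A' = p + 2 - card B"
      by (rule obtain_subset_with_card_n)
    moreover have "card A' > 0" "card A' < card B" "card B + card A' = p + 2"
      using \<open>card A' = _\<close> 3 assms(3,6) by linarith+
    moreover from this have "A' \<noteq> {}" by auto
    ultimately show thesis using 3 assms(2,5) by (intro that[of A' B]) auto
  qed
qed

theorem theorem3p1:
  fixes p :: nat and A B :: "int set"
  assumes "prime p"
    and "A \<subseteq> carrier (residue_ring (int p))" and "A \<noteq> {}"
    and "B \<subseteq> carrier (residue_ring (int p))" and "B \<noteq> {}"
    and "card A \<noteq> card B"
  shows "int (card (restricted_sumset (residue_ring (int p)) A B))
           \<ge> min (int p) (int (card A) + int (card B) - 2)"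
proof -
  let ?C = "restricted_sumset (residue_ring (int p)) A B"
  have p: "prime (int p)" using assms(1) by simp
  have sub: "A \<subseteq> {0..<int p}" "B \<subseteq> {0..<int p}"
    using assms(2,4) by (auto simp: residue_ring_def)
  then have fin: "finite A" "finite B" by (auto intro: finite_subset)
  have le: "card A \<le> p" "card B \<le> p"
    using card_mono[OF _ sub(1)] card_mono[OF _ sub(2)] by auto
  have C: "?C = {(a + b) mod int p | a b. a \<in> A \<and> b \<in> B \<and> a \<noteq> b}"
    by (auto simp: restricted_sumset_def residue_ring_def)
  have "?C \<subseteq> (\<lambda>(a, b). (a + b) mod int p) ` (A \<times> B)" unfolding C by auto
  then have finC: "finite ?C" using fin by (meson finite_SigmaI finite_imageI finite_subset)
  obtain A' B' where A': "A' \<subseteq> A" "A' \<noteq> {}" and B': "B' \<subseteq> B" "B' \<noteq> {}"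
    and neq: "card A' \<noteq> card B'" and card: "card A' + card B' = min (p + 2) (card A + card B)"
    using exists_subsets_card_sum_le[OF fin(1) assms(3) le(1) fin(2) assms(5) le(2) assms(6)] .
  \<comment> \<open>The full restricted sumset, taken as residues, covers the sums from
    \<open>A'\<close> and \<open>B'\<close> modulo \<open>p\<close>.\<close>
  have "card A' + card B' - 2 \<le> card ?C"
  proof (rule card_sum_cover_ge[OF p A'(2) _ B'(2) _ neq _ finC])
    fix a b assume "a \<in> A'" "b \<in> B'" "a \<noteq> b"
    then have "(a + b) mod int p \<in> ?C" using A'(1) B'(1) unfolding C by blast
    then show "\<exists>c\<in>?C. int p dvd a + b - c" by (rule bexI[rotated]) simp
  qed (use A' B' sub card in auto)
  then show ?thesis unfolding card by linarith
qed

end
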